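(* Let $\mathbb{X},\mathbb{Y}$ be real polyhedral Banach spaces with $\dim(\mathbb{X})=n$ and $\dim(\mathbb{Y})=m$. Let $T\in\mathbb{L}(\mathbb{X},\mathbb{Y})$ with $\|T\|=1$. Then $T$ is an extreme contraction if and only if $T$ is $mn$-smooth.
   Context: All Banach spaces are real. $\mathbb{L}(\mathbb{X},\mathbb{Y})$ is the space of bounded linear operators from $\mathbb{X}$ to $\mathbb{Y}$ with the operator norm. A finite-dimensional Banach space is called polyhedral if its closed unit ball has only finitely many extreme points. An operator $T\in\mathbb{L}(\mathbb{X},\mathbb{Y})$ is an extreme contraction if it is an extreme point of the closed unit ball of $\mathbb{L}(\mathbb{X},\mathbb{Y})$. For a Banach space $\mathbb{Z}$ and $z\in\mathbb{Z}$ with $\|z\|=1$, let $J(z)=\{z^*\in\mathbb{Z}^*:\|z^*\|=1,\ z^*(z)=1\}$; the element $z$ is called $k$-smooth if $\dim\operatorname{span}J(z)=k$. A norm-one operator $T$ is $k$-smooth if it is $k$-smooth as an element of the Banach space $\mathbb{L}(\mathbb{X},\mathbb{Y})$. *)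

theory Defs
  imports "HOL-Analysis.Analysis"
begin

text \<open>Finite dimension is required explicitly wherever \<^const>\<open>dim\<close> is used, because
  \<^const>\<open>dim\<close> takes the junk value 0 on infinite-dimensional subspaces.\<close>

definition finite_dimensional :: "'a::real_vector set \<Rightarrow> bool"
  where "finite_dimensional V \<longleftrightarrow> (\<exists>B. finite B \<and> V \<subseteq> span B)"

definition polyhedral_space :: "'a::banach itself \<Rightarrow> bool"
  where "polyhedral_space _ \<longleftrightarrow>
    finite_dimensional (UNIV :: 'a set) \<and>
    finite {x :: 'a. x extreme_point_of cball 0 1}"

definition extreme_contraction :: "('a::real_normed_vector \<Rightarrow>\<^sub>L 'b::real_normed_vector) \<Rightarrow> bool"
  where "extreme_contraction T \<longleftrightarrow> T extreme_point_of cball 0 1"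

definition support_functionals :: "'z::real_normed_vector \<Rightarrow> ('z \<Rightarrow>\<^sub>L real) set"
  where "support_functionals z = {f. norm f = 1 \<and> blinfun_apply f z = 1}"

definition k_smooth :: "nat \<Rightarrow> 'z::real_normed_vector \<Rightarrow> bool"
  where "k_smooth k z \<longleftrightarrow>
    norm z = 1 \<and>
    finite_dimensional (span (support_functionals z)) \<and>
    dim (span (support_functionals z)) = k"

end

theory Submission
  imports Defs
begin

text \<open>Since the unit balls are polytopes, the unit ball of the operator space is cut out by finitely
  many functionals \<open>A \<mapsto> g (A x)\<close>, where \<open>x\<close> is an extreme point of the domain ball and \<open>g\<close>
  defines a facet of the codomain ball. An operator \<open>S\<close> annihilated by all of these functionals that
  equal 1 at \<open>T\<close> admits \<open>\<epsilon> > 0\<close> with \<open>T \<plusminus> \<epsilon> S\<close> in the ball; so if \<open>T\<close> is extreme, these functionals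
  separate points, and hence they span the \<open>m n\<close>-dimensional dual. Conversely, support functionals
  at \<open>T\<close> are constant on every segment of the ball through \<open>T\<close>, so if they span the dual, the segment
  is degenerate.\<close>

section \<open>Coordinates on finite-dimensional normed spaces\<close>

text \<open>The index type depends on the space, so that \<open>real ^ 'a coord\<close> is a Euclidean space isomorphic
  to a finite-dimensional \<open>'a\<close>. Types being inhabited, this fails for dimension 0.\<close>

typedef (overloaded) ('a::real_vector) coord = "{i. i < dim (UNIV :: 'a set)} \<union> {0::nat}"
  by blast

instance coord :: (real_vector) finite
proof
  have "finite (range (Rep_coord :: 'a coord \<Rightarrow> nat))"
    unfolding type_definition.Rep_range[OF type_definition_coord] by simp
  moreover have "inj (Rep_coord :: 'a coord \<Rightarrow> nat)"
    by (rule injI) (rule Rep_coord_inject[THEN iffD1])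
  ultimately show "finite (UNIV :: 'a coord set)"
    by (rule finite_imageD)
qed

lemma card_coord:
  assumes "dim (UNIV :: 'a::real_vector set) > 0"
  shows "CARD('a coord) = dim (UNIV :: 'a set)"
proof -
  have "CARD('a coord) = card ({i. i < dim (UNIV :: 'a set)} \<union> {0::nat})"
    by (rule type_definition.card[OF type_definition_coord])
  also have "{i. i < dim (UNIV :: 'a set)} \<union> {0::nat} = {..<dim (UNIV :: 'a set)}"
    using assms by auto
  finally show ?thesis by simp
qed

lemma finite_dimensional_basis:
  assumes "finite_dimensional (UNIV :: 'a::real_vector set)"
  obtains B :: "'a::real_vector set"
  where "finite B" "independent B" "span B = UNIV" "card B = dim (UNIV :: 'a set)"
proof -
  obtain C :: "'a set" where C: "finite C" "UNIV \<subseteq> span C"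
    using assms by (auto simp: finite_dimensional_def)
  obtain B :: "'a set" where B: "independent B" "UNIV \<subseteq> span B" "card B = dim (UNIV :: 'a set)"
    using basis_exists[of "UNIV :: 'a set"] by metis
  have "finite B"
    using independent_span_bound[OF C(1) B(1)] C(2) by blast
  then show thesis using that[OF _ B(1) _ B(3)] B(2) by blast
qed

text \<open>Coordinates are available only in positive dimension; a nonzero vector supplies this,
  since a basis with no elements spans only 0.\<close>

lemma dim_UNIV_pos:
  assumes "finite_dimensional (UNIV :: 'a::real_vector set)" and "(x :: 'a) \<noteq> 0"
  shows "dim (UNIV :: 'a set) > 0"
proof (rule ccontr)
  assume dim0: "\<not> ?thesis"
  obtain B :: "'a set" where B: "finite B" "span B = UNIV" "card B = dim (UNIV :: 'a set)"
    using finite_dimensional_basis[OF assms(1)] by metis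
  have "card B = 0"
    using dim0 B(3) by linarith
  then have "B = {}"
    using B(1) by (simp only: card_0_eq)
  moreover have "x \<in> span B"
    unfolding B(2) by (rule UNIV_I)
  ultimately show False
    using assms(2) by simp
qed

text \<open>The unit sphere is compact, so \<open>norm (f v)\<close> attains a minimum there;
  injectivity makes it positive, and homogeneity carries it to all vectors. This bound is what makes
  the inverse of a coordinate map continuous.\<close>

lemma inj_linear_bounded_below:
  fixes f :: "'e::euclidean_space \<Rightarrow> 'a::real_normed_vector"
  assumes "linear f" "inj f"
  obtains c where "c > 0" "\<And>v. c * norm v \<le> norm (f v)"
proof -
  have "continuous_on (sphere 0 1) (\<lambda>v. norm (f v))"
    using assms(1) by (intro continuous_intros linear_continuous_on) (simp add: linear_conv_bounded_linear)
  moreover have "sphere (0::'e) 1 \<noteq> {}"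
    by simp
  ultimately obtain w where w: "w \<in> sphere 0 1" "\<forall>v \<in> sphere 0 1. norm (f w) \<le> norm (f v)"
    using continuous_attains_inf[OF compact_sphere, of 0 1 "\<lambda>v. norm (f v)"] by blast
  show thesis
  proof (rule that[of "norm (f w)"])
    have "w \<noteq> 0"
      using w(1) by auto
    then show "norm (f w) > 0"
      using assms linear_injective_0 by fastforce
    show "norm (f w) * norm v \<le> norm (f v)" for v
    proof (cases "v = 0")
      case False
      then have "v /\<^sub>R norm v \<in> sphere 0 1"
        by simp
      then have "norm (f w) \<le> norm (f (v /\<^sub>R norm v))"
        using w(2) by blast
      also have "\<dots> = norm (f v) / norm v"
        using linear_scale[OF assms(1)] by (simp add: divide_inverse mult.commute)
      finally show ?thesis
        using False by (simp add: field_simps)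
    qed simp
  qed
qed

text \<open>Linear combinations of a basis give the map from coordinates. Being bounded in both
  directions, the isomorphism lets Euclidean results on convex sets be transferred to an abstract
  normed space.\<close>

lemma coordinate_isomorphism:
  assumes fin: "finite_dimensional (UNIV :: 'a::real_normed_vector set)"
    and pos: "dim (UNIV :: 'a set) > 0"
  obtains \<phi> :: "real ^ 'a::real_normed_vector coord \<Rightarrow> 'a" and \<psi> :: "'a \<Rightarrow> real ^ 'a coord"
  where "bounded_linear \<phi>" "bounded_linear \<psi>" "\<And>v. \<psi> (\<phi> v) = v" "\<And>x. \<phi> (\<psi> x) = x"
proof -
  obtain B :: "'a set" where B: "finite B" "independent B" "span B = UNIV"
      "card B = dim (UNIV :: 'a set)"
    using finite_dimensional_basis[OF fin] .
  obtain b where b: "bij_betw b (UNIV :: 'a coord set) B"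
    using finite_same_card_bij[of "UNIV :: 'a coord set" B] B card_coord[OF pos] by auto
  define \<phi> :: "real ^ 'a coord \<Rightarrow> 'a" where "\<phi> v = (\<Sum>i\<in>UNIV. v $ i *\<^sub>R b i)" for v
  have lin: "linear \<phi>"
    by (rule linearI) (simp_all add: \<phi>_def scaleR_add_left sum.distrib scaleR_sum_right)
  have "inj \<phi>"
  proof (subst linear_injective_0[OF lin], intro allI impI)
    fix v assume v0: "\<phi> v = 0"
    \<comment> \<open>Reindexing the sum by basis vectors instead of indices puts it in the form to
      which independence of \<open>B\<close> applies.\<close>
    have "(\<Sum>x\<in>B. v $ inv_into UNIV b x *\<^sub>R x) = \<phi> v"
      unfolding \<phi>_def
      by (subst sum.reindex_bij_betw[OF b, symmetric])
        (use b in \<open>simp add: bij_betw_def\<close>)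
    then have "v $ inv_into UNIV b x = 0" if "x \<in> B" for x
      using v0 that by (intro independentD[OF B(2,1) subset_refl]) simp_all
    moreover have "b i \<in> B" "inv_into UNIV b (b i) = i" for i
      using b by (auto simp: bij_betw_def)
    ultimately show "v = 0"
      by (metis vec_eq_iff zero_index)
  qed
  have "B \<subseteq> range \<phi>"
  proof
    fix x assume "x \<in> B"
    then obtain i where i: "x = b i"
      using b by (auto simp: bij_betw_def)
    have "\<phi> (axis i 1) = (\<Sum>j\<in>UNIV. if j = i then b j else 0)"
      unfolding \<phi>_def by (intro sum.cong refl) (simp add: axis_def)
    also have "\<dots> = x"
      by (simp add: i)
    finally show "x \<in> range \<phi>"
      by (rule range_eqI[OF sym])
  qed
  then have "surj \<phi>"
    using span_minimal[OF _ linear_subspace_image[OF lin subspace_UNIV]] B(3) by blast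
  define \<psi> where "\<psi> = inv \<phi>"
  have \<psi>\<phi>: "\<psi> (\<phi> v) = v" and \<phi>\<psi>: "\<phi> (\<psi> x) = x" for v x
    using \<open>inj \<phi>\<close> \<open>surj \<phi>\<close> by (simp_all add: \<psi>_def surj_f_inv_f)
  obtain c where c: "c > 0" "\<And>v. c * norm v \<le> norm (\<phi> v)"
    using inj_linear_bounded_below[OF lin \<open>inj \<phi>\<close>] by blast
  have "bounded_linear \<psi>"
  proof (rule bounded_linear_intro)
    show "\<psi> (x + y) = \<psi> x + \<psi> y" for x y
      by (metis \<psi>\<phi> \<phi>\<psi> linear_add[OF lin])
    show "\<psi> (r *\<^sub>R x) = r *\<^sub>R \<psi> x" for r x
      by (metis \<psi>\<phi> \<phi>\<psi> linear_scale[OF lin])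
    show "norm (\<psi> x) \<le> norm x * (1 / c)" for x
      using c(2)[of "\<psi> x"] c(1) by (simp add: \<phi>\<psi> field_simps)
  qed
  with lin \<psi>\<phi> \<phi>\<psi> show thesis
    by (intro that[of \<phi> \<psi>]) (simp_all add: linear_conv_bounded_linear)
qed

section \<open>Polyhedral unit balls\<close>

lemma extreme_point_of_linear_image:
  assumes "linear f" "inj f"
  shows "f x extreme_point_of f ` S \<longleftrightarrow> x extreme_point_of S"
  by (simp add: extreme_point_of_def open_segment_linear_image[OF assms]
      inj_image_mem_iff[OF assms(2)])

text \<open>In coordinates the ball is compact and convex, so Minkowski's theorem makes it the hull
  of its finitely many extreme points. It is then a polytope, hence a finite intersection of
  half-spaces, and both descriptions are pulled back.\<close>

lemma polyhedral_unit_ball: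
  assumes poly: "polyhedral_space TYPE('a::banach)"
    and pos: "dim (UNIV :: 'a set) > 0"
  shows polyhedral_ball_eq_hull:
      "cball (0::'a) 1 = convex hull {x. x extreme_point_of cball 0 1}"
    and polyhedral_ball_finite_functionals:
      "\<exists>G :: ('a \<Rightarrow>\<^sub>L real) set. finite G \<and> (\<forall>x. norm x \<le> 1 \<longleftrightarrow> (\<forall>g\<in>G. blinfun_apply g x \<le> 1))"
proof -
  have fin: "finite_dimensional (UNIV :: 'a set)"
    and finext: "finite {x :: 'a. x extreme_point_of cball 0 1}"
    using poly by (auto simp: polyhedral_space_def)
  obtain \<phi> :: "real ^ 'a coord \<Rightarrow> 'a" and \<psi>
    where \<phi>: "bounded_linear \<phi>" and \<psi>: "bounded_linear \<psi>"
      and inv: "\<And>v. \<psi> (\<phi> v) = v" "\<And>x. \<phi> (\<psi> x) = x"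
    using coordinate_isomorphism[OF fin pos] by metis
  have lin: "linear \<phi>" "linear \<psi>"
    using \<phi> \<psi> by (auto intro: bounded_linear.linear)
  have inj: "inj \<psi>"
    by (rule inj_on_inverseI[of _ \<phi>]) (rule inv(2))
  define C where "C = \<psi> ` cball 0 1"
  have C_iff: "v \<in> C \<longleftrightarrow> norm (\<phi> v) \<le> 1" for v
  proof
    show "norm (\<phi> v) \<le> 1" if "v \<in> C"
      using that by (auto simp: C_def inv(2))
    show "v \<in> C" if "norm (\<phi> v) \<le> 1"
      unfolding C_def using that inv(1) by (intro image_eqI[of _ _ "\<phi> v"]) simp_all
  qed
  then have C_vimage: "C = \<phi> -` cball 0 1"
    by (intro set_eqI) simp
  have "bounded C"
    unfolding C_def using bounded_linear_image[OF bounded_cball \<psi>] .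
  moreover have "closed C"
    unfolding C_vimage by (intro closed_vimage closed_cball linear_continuous_on \<phi>)
  ultimately have "compact C"
    by (simp add: compact_eq_bounded_closed)
  moreover have "convex C"
    unfolding C_def by (intro convex_linear_image lin convex_cball)
  ultimately have KM: "C = convex hull {v. v extreme_point_of C}"
    by (rule Krein_Milman_Minkowski)
  have ext: "{v. v extreme_point_of C} = \<psi> ` {x. x extreme_point_of cball 0 1}"
    unfolding C_def using extreme_point_of_linear_image[OF lin(2) inj]
    by (auto simp: image_iff) (metis inv(1))
  have "\<psi> ` cball 0 1 = \<psi> ` (convex hull {x. x extreme_point_of cball 0 1})"
    using KM unfolding ext by (simp only: C_def convex_hull_linear_image[OF lin(2)])
  then show "cball (0::'a) 1 = convex hull {x. x extreme_point_of cball 0 1}"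
    using inj by (simp add: inj_image_eq_iff)
  have "polytope C"
    unfolding polytope_def using KM ext finext by (metis finite_imageI)
  then obtain F where F: "finite F" "C = \<Inter> F" "\<forall>h\<in>F. \<exists>a b. a \<noteq> 0 \<and> h = {v. a \<bullet> v \<le> b}"
    using polytope_imp_polyhedron[of C] unfolding polyhedron_def by blast
  \<comment> \<open>Each half-space can be normalised to right-hand side 1 because its bound
    \<open>b\<close> is positive: \<open>C\<close> contains a positive multiple of the normal
    \<open>a\<close>. The factor \<open>1 / (K * norm a)\<close> is chosen so that
    \<open>\<phi>\<close> maps this multiple into the unit ball.\<close>
  have "\<exists>a. h = {v. a \<bullet> v \<le> 1}" if "h \<in> F" for h
  proof -
    obtain a b where ab: "a \<noteq> 0" "h = {v. a \<bullet> v \<le> b}"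
      using F(3) \<open>h \<in> F\<close> by blast
    obtain K where K: "K > 0" "\<And>v. norm (\<phi> v) \<le> norm v * K"
      using bounded_linear.pos_bounded[OF \<phi>] by blast
    have "norm (\<phi> ((1 / (K * norm a)) *\<^sub>R a)) \<le> 1"
      using K(2)[of "(1 / (K * norm a)) *\<^sub>R a"] K(1) ab(1) by simp
    then have "(1 / (K * norm a)) *\<^sub>R a \<in> h"
      using C_iff F(2) \<open>h \<in> F\<close> by blast
    then have "a \<bullet> a / (K * norm a) \<le> b"
      unfolding ab(2) by simp
    then have "b > 0"
      using K(1) ab(1) by (smt (verit) divide_pos_pos inner_gt_zero_iff mult_pos_pos zero_less_norm_iff)
    then have "h = {v. (a /\<^sub>R b) \<bullet> v \<le> 1}"
      unfolding ab(2) by (auto simp: field_simps)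
    then show ?thesis by blast
  qed
  then obtain a where a: "\<And>h. h \<in> F \<Longrightarrow> h = {v. a h \<bullet> v \<le> 1}"
    by metis
  define G where "G = (\<lambda>h. Blinfun (\<lambda>x. a h \<bullet> \<psi> x)) ` F"
  have G: "blinfun_apply (Blinfun (\<lambda>x. a h \<bullet> \<psi> x)) x = a h \<bullet> \<psi> x" for h x
    by (subst bounded_linear_Blinfun_apply)
      (auto intro: bounded_linear_compose[OF bounded_linear_inner_right \<psi>])
  have "norm x \<le> 1 \<longleftrightarrow> (\<forall>g\<in>G. blinfun_apply g x \<le> 1)" for x
  proof -
    have "norm x \<le> 1 \<longleftrightarrow> \<psi> x \<in> \<Inter> F"
      using C_iff[of "\<psi> x"] F(2) by (simp add: inv)
    also have "\<dots> \<longleftrightarrow> (\<forall>h\<in>F. a h \<bullet> \<psi> x \<le> 1)"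
      using a by blast
    finally show ?thesis
      by (simp add: G_def G)
  qed
  then show "\<exists>G :: ('a \<Rightarrow>\<^sub>L real) set. finite G \<and> (\<forall>x. norm x \<le> 1 \<longleftrightarrow> (\<forall>g\<in>G. blinfun_apply g x \<le> 1))"
    using F(1) by (intro exI[of _ G]) (simp add: G_def)
qed

section \<open>Spanning sets of functionals\<close>

text \<open>Induction on \<open>F\<close>. If \<open>f\<close> vanishes on the common kernel of
  \<open>F\<close>, it adds no constraint; otherwise subtracting a suitable multiple of
  \<open>f\<close> from \<open>h\<close> gives a functional that vanishes on that kernel.\<close>

lemma blinfun_in_span_of_common_kernel:
  fixes h :: "'z::real_normed_vector \<Rightarrow>\<^sub>L real"
  assumes "finite F" and "\<And>z. (\<forall>f\<in>F. blinfun_apply f z = 0) \<Longrightarrow> blinfun_apply h z = 0"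
  shows "h \<in> span F"
  using assms
proof (induction F arbitrary: h rule: finite_induct)
  case empty
  then have "h = 0"
    by (intro blinfun_eqI) simp
  then show ?case by simp
next
  case (insert f F)
  show ?case
  proof (cases "\<exists>z. (\<forall>g\<in>F. blinfun_apply g z = 0) \<and> blinfun_apply f z \<noteq> 0")
    case False
    then have "h \<in> span F"
      using insert.prems by (intro insert.IH) auto
    then show ?thesis
      using span_mono[of F "insert f F"] by blast
  next
    case True
    then obtain w where w: "\<forall>g\<in>F. blinfun_apply g w = 0" "f w \<noteq> 0"
      by blast
    define c where "c = h w / f w"
    have "h - c *\<^sub>R f \<in> span F"
    proof (rule insert.IH)
      fix z assume z: "\<forall>g\<in>F. blinfun_apply g z = 0"
      \<comment> \<open>The argument is the projection of \<open>z\<close> along \<open>w\<close>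
        onto the kernel of \<open>f\<close>; it stays in the common kernel of \<open>F\<close>
        because \<open>w\<close> lies there.\<close>
      have "h (z - (f z / f w) *\<^sub>R w) = 0"
        using z w by (intro insert.prems) (simp add: blinfun.diff_right blinfun.scaleR_right)
      then show "blinfun_apply (h - c *\<^sub>R f) z = 0"
        by (simp add: blinfun.diff_right blinfun.scaleR_right blinfun.diff_left
            blinfun.scaleR_left c_def mult.commute)
    qed
    then show ?thesis
      using span_breakdown_eq by blast
  qed
qed

text \<open>The common kernel of the \<open>e i\<close> is trivial, so they span the dual;
  evaluation at \<open>u j\<close> isolates the coefficient of \<open>e j\<close>, so they are
  independent.\<close>

lemma dual_biorthogonal_basis:
  fixes e :: "'i::finite \<Rightarrow> ('z::real_normed_vector \<Rightarrow>\<^sub>L real)" and u :: "'i \<Rightarrow> 'z"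
  assumes biorth: "\<And>i j. e i (u j) = (if i = j then 1 else 0)"
    and sep: "\<And>z. (\<And>i. e i z = 0) \<Longrightarrow> z = 0"
  shows "span (range e) = UNIV" and "dim (UNIV :: ('z \<Rightarrow>\<^sub>L real) set) = CARD('i)"
proof -
  show sp: "span (range e) = UNIV"
  proof (intro UNIV_eq_I[symmetric] blinfun_in_span_of_common_kernel)
    fix h :: "'z \<Rightarrow>\<^sub>L real" and z assume "\<forall>f\<in>range e. blinfun_apply f z = 0"
    then have "z = 0"
      by (intro sep) simp
    then show "blinfun_apply h z = 0"
      by simp
  qed simp
  have inj: "inj e"
    using biorth by (intro injI) (metis zero_neq_one)
  have "independent (range e)"
  proof (rule independent_if_scalars_zero)
    fix c x assume sum0: "(\<Sum>f\<in>range e. c f *\<^sub>R f) = 0" and "x \<in> range e"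
    then obtain j where j: "x = e j"
      by blast
    have "(\<Sum>i\<in>UNIV. c (e i) *\<^sub>R e i) = 0"
      using sum0 unfolding sum.reindex[OF inj] o_def .
    then have "0 = blinfun_apply (\<Sum>i\<in>UNIV. c (e i) *\<^sub>R e i) (u j)"
      by (simp only: zero_blinfun.rep_eq)
    also have "\<dots> = (\<Sum>i\<in>UNIV. if i = j then c (e i) else 0)"
      by (simp add: blinfun.sum_left blinfun.scaleR_left biorth if_distrib cong: if_cong)
    also have "\<dots> = c x"
      by (simp add: j)
    finally show "c x = 0" by simp
  qed simp
  then show "dim (UNIV :: ('z \<Rightarrow>\<^sub>L real) set) = CARD('i)"
    by (rule dim_unique[OF subset_UNIV equalityD2[OF sp] _ card_image[OF inj]])
qed

text \<open>A vector outside the span of a basis of \<open>S\<close> would extend it to an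
  independent set larger than a basis of the whole space.\<close>

lemma span_eq_UNIV_if_dim_eq:
  fixes S :: "'v::real_vector set"
  assumes fin: "finite_dimensional (UNIV :: 'v set)" and "dim S = dim (UNIV :: 'v set)"
  shows "span S = UNIV"
proof -
  obtain E :: "'v set" where E: "finite E" "span E = UNIV" "card E = dim (UNIV :: 'v set)"
    using finite_dimensional_basis[OF fin] by metis
  obtain D where D: "D \<subseteq> S" "independent D" "card D = dim S"
    using basis_exists[of S] by metis
  have "x \<in> span D" for x
  proof (rule ccontr)
    assume x: "x \<notin> span D"
    then have "x \<notin> D"
      using span_base by metis
    have "independent (insert x D)"
      using x D(2) by (rule independent_insertI)
    moreover have "insert x D \<subseteq> span E"
      unfolding E(2) by (rule subset_UNIV)
    ultimately have "finite (insert x D) \<and> card (insert x D) \<le> card E"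
      by (rule independent_span_bound[OF E(1)])
    then show False
      using \<open>x \<notin> D\<close> D(3) E(3) assms(2) by auto
  qed
  then show ?thesis
    using span_mono[OF D(1)] by blast
qed

section \<open>Operators between polyhedral spaces\<close>

text \<open>The matrix entries of an operator are coordinate functionals on the operator space,
  biorthogonal to the matrix units. They form a basis of the dual and already separate operators,
  which gives the third claim.\<close>

lemma operator_dual_dimension:
  assumes finX: "finite_dimensional (UNIV :: 'a::real_normed_vector set)"
    and posX: "dim (UNIV :: 'a set) > 0"
    and finY: "finite_dimensional (UNIV :: 'b::real_normed_vector set)"
    and posY: "dim (UNIV :: 'b set) > 0"
  shows "finite_dimensional (UNIV :: (('a \<Rightarrow>\<^sub>L 'b) \<Rightarrow>\<^sub>L real) set)"
    and "dim (UNIV :: (('a \<Rightarrow>\<^sub>L 'b) \<Rightarrow>\<^sub>L real) set) = dim (UNIV :: 'b set) * dim (UNIV :: 'a set)"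
    and "(\<And>f :: ('a \<Rightarrow>\<^sub>L 'b) \<Rightarrow>\<^sub>L real. f A = 0) \<Longrightarrow> A = 0"
proof -
  obtain \<phi> :: "real ^ 'a coord \<Rightarrow> 'a" and \<psi>
    where \<phi>: "bounded_linear \<phi>" and \<psi>: "bounded_linear \<psi>"
      and inv: "\<And>v. \<psi> (\<phi> v) = v" "\<And>x. \<phi> (\<psi> x) = x"
    using coordinate_isomorphism[OF finX posX] by metis
  obtain \<phi>' :: "real ^ 'b coord \<Rightarrow> 'b" and \<psi>'
    where \<phi>': "bounded_linear \<phi>'" and \<psi>': "bounded_linear \<psi>'"
      and inv': "\<And>v. \<psi>' (\<phi>' v) = v" "\<And>x. \<phi>' (\<psi>' x) = x"
    using coordinate_isomorphism[OF finY posY] by metis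
  \<comment> \<open>\<open>e (j, i)\<close> reads off the entry in row \<open>j\<close> and column
    \<open>i\<close>; \<open>u (j, i)\<close> is the corresponding matrix unit.\<close>
  define e where "e = (\<lambda>(j, i). Blinfun (\<lambda>A :: 'a \<Rightarrow>\<^sub>L 'b. \<psi>' (A (\<phi> (axis i 1))) $ j))"
  define u where "u = (\<lambda>(j, i). Blinfun (\<lambda>x. (\<psi> x $ i) *\<^sub>R \<phi>' (axis j 1)))"
  have e: "e (j, i) A = \<psi>' (A (\<phi> (axis i 1))) $ j" for j i A
    unfolding e_def prod.case
    by (subst bounded_linear_Blinfun_apply)
      (auto intro: bounded_linear_compose[OF bounded_linear_vec_nth
          bounded_linear_compose[OF \<psi>' blinfun.bounded_linear_left]])
  have u: "u (j, i) x = (\<psi> x $ i) *\<^sub>R \<phi>' (axis j 1)" for j i x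
    unfolding u_def prod.case
    by (subst bounded_linear_Blinfun_apply)
      (auto intro!: bounded_linear_scaleR_const bounded_linear_compose[OF bounded_linear_vec_nth \<psi>])
  have biorth: "e p (u q) = (if p = q then 1 else 0)" for p q
    by (cases p; cases q)
      (auto simp: e u inv inv' linear_scale[OF bounded_linear.linear[OF \<psi>']] axis_def)
  have sep: "A = 0" if "\<And>p. e p A = 0" for A
  proof (rule blinfun_eqI)
    fix x
    have lin: "linear (\<lambda>v. A (\<phi> v))"
      by (intro bounded_linear.linear bounded_linear_compose[OF blinfun.bounded_linear_right \<phi>])
    have "\<psi>' (A (\<phi> (axis i 1))) = 0" for i
      using that e by (metis vec_eq_iff zero_index)
    then have "A (\<phi> (axis i 1)) = 0" for i
      by (metis inv'(2) linear_0[OF bounded_linear.linear[OF \<phi>']])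
    then have "A (\<phi> (\<Sum>i\<in>UNIV. v $ i *\<^sub>R axis i 1)) = 0" for v
      by (simp add: linear_sum[OF lin] linear_scale[OF lin])
    moreover have "(\<Sum>i\<in>UNIV. v $ i *\<^sub>R axis i 1) = v" for v :: "real ^ 'a coord"
      using basis_expansion[of v] by (simp only: scalar_mult_eq_scaleR)
    ultimately have "A (\<phi> v) = 0" for v
      by (simp only:)
    then show "A x = blinfun_apply 0 x"
      by (metis inv(2) zero_blinfun.rep_eq)
  qed
  note basis = dual_biorthogonal_basis[of e u, OF biorth sep]
  show "finite_dimensional (UNIV :: (('a \<Rightarrow>\<^sub>L 'b) \<Rightarrow>\<^sub>L real) set)"
    unfolding finite_dimensional_def using basis(1)
    by (intro exI[of _ "range e"]) simp
  show "dim (UNIV :: (('a \<Rightarrow>\<^sub>L 'b) \<Rightarrow>\<^sub>L real) set) = dim (UNIV :: 'b set) * dim (UNIV :: 'a set)"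
    using basis(2) by (simp add: card_coord[OF posX] card_coord[OF posY])
  show "A = 0" if "\<And>f :: ('a \<Rightarrow>\<^sub>L 'b) \<Rightarrow>\<^sub>L real. f A = 0" for A
    using that sep by blast
qed

text \<open>It suffices to test an operator on the extreme points of the domain ball, and each image
  against the functionals that cut out the codomain ball. Both sets are finite, hence so is the set
  of pairs.\<close>

lemma operator_ball_finite_functionals:
  assumes polyX: "polyhedral_space TYPE('a::banach)" and posX: "dim (UNIV :: 'a set) > 0"
    and polyY: "polyhedral_space TYPE('b::banach)" and posY: "dim (UNIV :: 'b set) > 0"
  obtains F :: "(('a::banach \<Rightarrow>\<^sub>L 'b::banach) \<Rightarrow>\<^sub>L real) set"
  where "finite F" "\<And>A. norm A \<le> 1 \<longleftrightarrow> (\<forall>f\<in>F. blinfun_apply f A \<le> 1)"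
proof -
  obtain G :: "('b \<Rightarrow>\<^sub>L real) set"
    where G: "finite G" "\<And>y. norm y \<le> 1 \<longleftrightarrow> (\<forall>g\<in>G. blinfun_apply g y \<le> 1)"
    using polyhedral_ball_finite_functionals[OF polyY posY] by blast
  define E where "E = {x :: 'a. x extreme_point_of cball 0 1}"
  have E: "finite E" "cball 0 1 = convex hull E"
    using polyX polyhedral_ball_eq_hull[OF polyX posX] by (auto simp: E_def polyhedral_space_def)
  define F where "F = (\<lambda>(x, g). Blinfun (\<lambda>A :: 'a \<Rightarrow>\<^sub>L 'b. blinfun_apply g (A x))) ` (E \<times> G)"
  have app: "Blinfun (\<lambda>A :: 'a \<Rightarrow>\<^sub>L 'b. blinfun_apply g (A x)) A = g (A x)" for g :: "'b \<Rightarrow>\<^sub>L real" and x A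
    by (subst bounded_linear_Blinfun_apply)
      (auto intro: bounded_linear_compose[OF blinfun.bounded_linear_right blinfun.bounded_linear_left])
  have "norm A \<le> 1 \<longleftrightarrow> (\<forall>f\<in>F. blinfun_apply f A \<le> 1)" for A
  proof -
    have "norm A \<le> 1 \<longleftrightarrow> (\<forall>x\<in>E. norm (A x) \<le> 1)"
    proof
      assume A: "norm A \<le> 1"
      show "\<forall>x\<in>E. norm (A x) \<le> 1"
      proof
        fix x assume "x \<in> E"
        then have "norm x \<le> 1"
          by (simp add: E_def extreme_point_of_def)
        then show "norm (A x) \<le> 1"
          using norm_blinfun[of A x] A mult_le_one[of "norm A" "norm x"] by simp
      qed
    next
      assume AE: "\<forall>x\<in>E. norm (A x) \<le> 1"
      \<comment> \<open>The points that \<open>A\<close> maps into the unit ball form a convex set,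
        so it contains the hull of \<open>E\<close> as soon as it contains \<open>E\<close>.\<close>
      have "convex (blinfun_apply A -` cball 0 1)"
        by (intro convex_linear_vimage bounded_linear.linear blinfun.bounded_linear_right convex_cball)
      moreover have "E \<subseteq> blinfun_apply A -` cball 0 1"
        using AE by auto
      ultimately have ball: "cball 0 1 \<subseteq> blinfun_apply A -` cball 0 1"
        using E(2) hull_minimal by metis
      show "norm A \<le> 1"
      proof (rule norm_blinfun_bound)
        fix x
        show "norm (A x) \<le> 1 * norm x"
        proof (cases "x = 0")
          case False
          then have "x /\<^sub>R norm x \<in> cball 0 1"
            by simp
          then have "norm (A (x /\<^sub>R norm x)) \<le> 1"
            using ball by (auto simp del: norm_scaleR)
          then show ?thesis
            using False by (simp add: blinfun.scaleR_right field_simps)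
        qed simp
      qed simp
    qed
    also have "\<dots> \<longleftrightarrow> (\<forall>f\<in>F. blinfun_apply f A \<le> 1)"
      using G(2) by (auto simp: F_def app)
    finally show ?thesis .
  qed
  with E(1) G(1) show thesis
    by (intro that[of F]) (simp_all add: F_def)
qed

text \<open>The functionals in \<open>F\<close> that vanish at \<open>S\<close> impose no constraint on \<open>\<epsilon>\<close>; each of the others is
  strictly below 1 at \<open>T\<close>.\<close>

lemma small_perturbation_in_ball:
  fixes T S :: "'z::real_normed_vector" and F :: "('z \<Rightarrow>\<^sub>L real) set"
  assumes "finite F" and ball: "\<And>A. norm A \<le> 1 \<longleftrightarrow> (\<forall>f\<in>F. blinfun_apply f A \<le> 1)"
    and T: "norm T \<le> 1" and S: "\<And>f. f \<in> F \<Longrightarrow> blinfun_apply f T = 1 \<Longrightarrow> blinfun_apply f S = 0"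
  obtains \<epsilon> :: real where "\<epsilon> > 0" "norm (T + \<epsilon> *\<^sub>R S) \<le> 1" "norm (T - \<epsilon> *\<^sub>R S) \<le> 1"
proof -
  have "\<forall>\<^sub>F t in at_right 0. blinfun_apply f (T + t *\<^sub>R S) \<le> 1 \<and> blinfun_apply f (T - t *\<^sub>R S) \<le> 1"
    if "f \<in> F" for f
  proof (cases "blinfun_apply f T = 1")
    case True
    then show ?thesis
      using S[OF \<open>f \<in> F\<close>] by (simp add: blinfun.add_right blinfun.diff_right blinfun.scaleR_right)
  next
    case False
    then have "f T < 1"
      using ball T \<open>f \<in> F\<close> by force
    \<comment> \<open>Both values tend to \<open>f T < 1\<close>, so the strict inequality persists
      for all small \<open>t > 0\<close>.\<close>
    moreover have "((\<lambda>t. blinfun_apply f (T + t *\<^sub>R S)) \<longlongrightarrow> f (T + 0 *\<^sub>R S)) (at_right 0)"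
      and "((\<lambda>t. blinfun_apply f (T - t *\<^sub>R S)) \<longlongrightarrow> f (T - 0 *\<^sub>R S)) (at_right 0)"
      by (intro tendsto_intros)+
    ultimately have "\<forall>\<^sub>F t in at_right 0. blinfun_apply f (T + t *\<^sub>R S) < 1"
      and "\<forall>\<^sub>F t in at_right 0. blinfun_apply f (T - t *\<^sub>R S) < 1"
      by (auto dest: order_tendstoD(2))
    then show ?thesis
      by eventually_elim simp
  qed
  \<comment> \<open>Finiteness of \<open>F\<close> allows one \<open>t\<close> to serve all
    constraints at once.\<close>
  then have "\<forall>\<^sub>F t in at_right 0. \<forall>f\<in>F. blinfun_apply f (T + t *\<^sub>R S) \<le> 1 \<and> blinfun_apply f (T - t *\<^sub>R S) \<le> 1"
    using assms(1) by (simp add: eventually_ball_finite)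
  then have "\<forall>\<^sub>F t in at_right (0::real). t > 0 \<and> norm (T + t *\<^sub>R S) \<le> 1 \<and> norm (T - t *\<^sub>R S) \<le> 1"
    using eventually_at_right_less[of "0::real"] by eventually_elim (simp add: ball)
  then show thesis
    using that eventually_happens'[OF trivial_limit_at_right_real] by blast
qed

section \<open>Support functionals at a point of norm one\<close>

text \<open>Testing the one-sided bound at both signs of a normalised vector gives
  \<open>norm f \<le> 1\<close>; the value at \<open>T\<close> gives the reverse inequality.\<close>

lemma support_functional_if_le_one_on_ball:
  fixes T :: "'z::real_normed_vector"
  assumes "\<And>A. norm A \<le> 1 \<Longrightarrow> blinfun_apply f A \<le> 1" and "norm T = 1" and "f T = 1"
  shows "f \<in> support_functionals T"
proof -
  have "norm f \<le> 1"
  proof (rule norm_blinfun_bound)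
    fix x
    show "norm (f x) \<le> 1 * norm x"
    proof (cases "x = 0")
      case False
      then have "f (x /\<^sub>R norm x) \<le> 1" "f (- (x /\<^sub>R norm x)) \<le> 1"
        by (auto intro!: assms(1))
      then show ?thesis
        using False by (simp add: blinfun.scaleR_right blinfun.minus_right field_simps abs_le_iff)
    qed simp
  qed simp
  moreover have "1 \<le> norm f"
    using norm_blinfun[of f T] assms(2,3) by simp
  ultimately show ?thesis
    using assms(3) by (simp add: support_functionals_def)
qed

text \<open>The value 1 at \<open>T\<close> is an average, with positive weights, of two values that
  are at most 1, so both equal 1.\<close>

lemma support_functional_eq_on_segment:
  assumes f: "f \<in> support_functionals T" and "norm A \<le> 1" "norm B \<le> 1" "T \<in> open_segment A B"
  shows "blinfun_apply f A = blinfun_apply f B"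
proof -
  obtain u where u: "0 < u" "u < 1" "T = (1 - u) *\<^sub>R A + u *\<^sub>R B"
    using assms(4) by (auto simp: in_segment)
  have "norm f = 1" "f T = 1"
    using f by (auto simp: support_functionals_def)
  then have le: "f A \<le> 1" "f B \<le> 1"
    using norm_blinfun[of f A] norm_blinfun[of f B] assms(2,3) by auto
  have eq: "(1 - u) * (1 - f A) + u * (1 - f B) = 0"
    using \<open>f T = 1\<close> unfolding u(3)
    by (simp only: blinfun.add_right blinfun.scaleR_right) (simp add: algebra_simps)
  have "(1 - u) * (1 - f A) \<ge> 0" "u * (1 - f B) \<ge> 0"
    using u le by simp_all
  with eq have "(1 - u) * (1 - f A) = 0" "u * (1 - f B) = 0"
    by linarith+
  then show ?thesis
    using u by simp
qed

section \<open>Extremality and smoothness compared through the span of the support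
  functionals\<close>

theorem theorem2p2:
  fixes T :: "'a::banach \<Rightarrow>\<^sub>L 'b::banach" and m n :: nat
  assumes "polyhedral_space TYPE('a)" and "polyhedral_space TYPE('b)"
    and "dim (UNIV :: 'a set) = n" and "dim (UNIV :: 'b set) = m"
    and "norm T = 1"
  shows "extreme_contraction T \<longleftrightarrow> k_smooth (m * n) T"
proof -
  let ?J = "support_functionals T"
  have fin: "finite_dimensional (UNIV :: 'a set)" "finite_dimensional (UNIV :: 'b set)"
    using assms(1,2) by (auto simp: polyhedral_space_def)
  \<comment> \<open>An operator of norm one is nonzero, which excludes trivial spaces on either
    side.\<close>
  obtain x where "T x \<noteq> 0"
    using assms(5) by (metis blinfun_eqI norm_zero zero_blinfun.rep_eq zero_neq_one)
  moreover from this have "x \<noteq> 0"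
    by auto
  ultimately have pos: "dim (UNIV :: 'a set) > 0" "dim (UNIV :: 'b set) > 0"
    using dim_UNIV_pos fin by blast+
  note dual = operator_dual_dimension[OF fin(1) pos(1) fin(2) pos(2)]
  \<comment> \<open>Since \<open>m * n\<close> is the dimension of the dual of the operator space,
    smoothness of this order says exactly that \<open>?J\<close> spans the dual.\<close>
  have "k_smooth (m * n) T \<longleftrightarrow> span ?J = UNIV"
  proof
    assume "k_smooth (m * n) T"
    then show "span ?J = UNIV"
      using span_eq_UNIV_if_dim_eq[OF dual(1), of ?J] dual(2) assms(3,4)
      by (simp add: k_smooth_def)
  next
    assume "span ?J = UNIV"
    then show "k_smooth (m * n) T"
      using dual(1,2) assms(3-5) by (simp add: k_smooth_def del: dim_span)
  qed
  moreover have "extreme_contraction T \<longleftrightarrow> span ?J = UNIV"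
  proof
    assume ext: "extreme_contraction T"
    obtain F :: "(('a \<Rightarrow>\<^sub>L 'b) \<Rightarrow>\<^sub>L real) set"
      where F: "finite F" "\<And>A. norm A \<le> 1 \<longleftrightarrow> (\<forall>f\<in>F. blinfun_apply f A \<le> 1)"
      using operator_ball_finite_functionals[OF assms(1) pos(1) assms(2) pos(2)] by blast
    \<comment> \<open>The constraints active at \<open>T\<close>; they are support functionals, so
      it is enough that they span the dual.\<close>
    define F\<^sub>1 where "F\<^sub>1 = {f\<in>F. blinfun_apply f T = 1}"
    have "F\<^sub>1 \<subseteq> ?J"
      using F(2) assms(5) by (auto simp: F\<^sub>1_def intro!: support_functional_if_le_one_on_ball)
    moreover have "h \<in> span F\<^sub>1" for h
    proof (rule blinfun_in_span_of_common_kernel)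
      show "finite F\<^sub>1"
        using F(1) by (simp add: F\<^sub>1_def)
      fix S assume S: "\<forall>f\<in>F\<^sub>1. blinfun_apply f S = 0"
      obtain \<epsilon> :: real where \<epsilon>: "\<epsilon> > 0" "norm (T + \<epsilon> *\<^sub>R S) \<le> 1" "norm (T - \<epsilon> *\<^sub>R S) \<le> 1"
        using small_perturbation_in_ball[OF F, of T S] S assms(5) by (auto simp: F\<^sub>1_def)
      have mid: "midpoint (T + \<epsilon> *\<^sub>R S) (T - \<epsilon> *\<^sub>R S) = T"
        by (simp add: midpoint_def scaleR_2[symmetric])
      \<comment> \<open>\<open>T\<close> is the midpoint of the two perturbed operators, so
        extremality forces them to coincide, that is, \<open>S = 0\<close>.\<close>
      have "T \<notin> open_segment (T + \<epsilon> *\<^sub>R S) (T - \<epsilon> *\<^sub>R S)"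
        using ext \<epsilon>(2,3) by (simp add: extreme_contraction_def extreme_point_of_def)
      then have "T + \<epsilon> *\<^sub>R S = T - \<epsilon> *\<^sub>R S"
        using midpoint_in_open_segment mid by metis
      then have "S = 0"
        using \<epsilon>(1) by (simp add: eq_neg_iff_add_eq_0 scaleR_2[symmetric] del: scaleR_scaleR)
      then show "blinfun_apply h S = 0"
        by simp
    qed
    ultimately show "span ?J = UNIV"
      using span_mono by blast
  next
    assume J: "span ?J = UNIV"
    have "T \<notin> open_segment A B" if "norm A \<le> 1" "norm B \<le> 1" for A B
    proof
      assume T: "T \<in> open_segment A B"
      \<comment> \<open>Vanishing at \<open>A - B\<close> is a linear condition on functionals, so
        it passes from \<open>?J\<close> to its span, the whole dual, which separates
        operators.\<close>
      have "subspace {f. blinfun_apply f (A - B) = 0}"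
        by (auto simp: subspace_def blinfun.add_left blinfun.scaleR_left)
      moreover have "?J \<subseteq> {f. blinfun_apply f (A - B) = 0}"
        using support_functional_eq_on_segment[OF _ that T] by (auto simp: blinfun.diff_right)
      ultimately have "span ?J \<subseteq> {f. blinfun_apply f (A - B) = 0}"
        by (rule span_minimal[rotated])
      then have "A - B = 0"
        using J by (intro dual(3)) blast
      with T show False by simp
    qed
    then show "extreme_contraction T"
      using assms(5) by (auto simp: extreme_contraction_def extreme_point_of_def)
  qed
  ultimately show ?thesis by blast
qed

end
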